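(* Let $K\le N$ and let $\mathbf{H}\in\mathbb{C}^{K\times N}$ have full row rank, with $\bar{\mathbf{H}}=\mathbf{H}\mathbf{H}^{\mathsf H}$. Consider the full problem over $(\mathbf{W},\mathbf{p})\in\mathbb{C}^{N\times K}\times\mathbb{R}^K$, $$\text{(P)}\qquad \max_{\mathbf{W},\mathbf{p}}\ \frac{B\,R(\mathbf{W})}{P_{\mathrm{tot}}(\mathbf{p})}\quad\text{s.t.}\quad \mathbf{W}^{\mathsf H}\mathbf{W}\preceq\operatorname{diag}(\mathbf{p}),\quad \alpha_q\mathbf{1}^{\mathsf T}\mathbf{p}\le P_{\max},$$ and the reduced problem over $(\mathbf{Y},\mathbf{p})\in\mathbb{C}^{K\times K}\times\mathbb{R}^K$, $\mathbf{p}\ge\mathbf{0}$, $$\text{(R)}\qquad \max_{\mathbf{Y},\mathbf{p}}\ \frac{B\,R(\mathbf{Y},\mathbf{p})}{P_{\mathrm{tot}}(\mathbf{p})}\quad\text{s.t.}\quad \|\mathbf{Y}\|_2\le1,\quad \alpha_q\mathbf{1}^{\mathsf T}\mathbf{p}\le P_{\max}.$$ Then (R) is an exact reformulation of (P), without any surrogate for rate or power. That is: for every feasible $(\mathbf{Y},\mathbf{p})$ of (R), setting $\mathbf{W}=\mathbf{H}^{\mathsf H}\bar{\mathbf{H}}^{-1/2}\mathbf{Y}\operatorname{diag}(\sqrt{\mathbf{p}})$, the pair $(\mathbf{W},\mathbf{p})$ is feasible for (P) with $R(\mathbf{W})=R(\mathbf{Y},\mathbf{p})$ and the same transmit and total power;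 for every feasible $(\mathbf{W},\mathbf{p})$ of (P) there is $\mathbf{Y}$ such that $(\mathbf{Y},\mathbf{p})$ is feasible for (R) with $R(\mathbf{Y},\mathbf{p})=R(\mathbf{W})$ and the same transmit and total power; consequently (P) and (R) have the same optimal value, and for any optimal $(\mathbf{Y},\mathbf{p})$ of (R), the pair $(\mathbf{W},\mathbf{p})$ with $\mathbf{W}=\mathbf{H}^{\mathsf H}\bar{\mathbf{H}}^{-1/2}\mathbf{Y}\operatorname{diag}(\sqrt{\mathbf{p}})$ is optimal for (P).
   Context: Constants: $B>0$, $\sigma^2>0$, $P_{\max}>0$, $\eta_{\mathrm{PA}}>0$, $P_{\mathrm{st}}>0$ (static power), $\beta_q\in(0,1)$ and $\alpha_q=1-\beta_q$. The $k$th row of $\mathbf{H}$ is $\mathbf{h}_k^{\mathsf H}$ and $\mathbf{w}_k$ is the $k$th column of $\mathbf{W}$. $\preceq$ is the Loewner order, $\|\cdot\|_2$ the spectral norm, $\bar{\mathbf{H}}^{\pm1/2}$ the Hermitian positive definite square root and its inverse, $\sqrt{\mathbf{p}}$ the entrywise square root. Full-space rate: $R(\mathbf{W})=\sum_{k=1}^K\log_2(1+\Gamma_k(\mathbf{W}))$ with $$\Gamma_k(\mathbf{W})=\frac{\alpha_q^2|\mathbf{h}_k^{\mathsf H}\mathbf{w}_k|^2}{\alpha_q^2\sum_{j\ne k}|\mathbf{h}_k^{\mathsf H}\mathbf{w}_j|^2+\mathbf{h}_k^{\mathsf H}\mathbf{R}_q\mathbf{h}_k+\sigma^2},\qquad \mathbf{R}_q=\alpha_q\beta_q\mathbf{W}\mathbf{W}^{\mathsf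 H}.$$ Reduced rate: with $\mathbf{C}=\bar{\mathbf{H}}^{1/2}\mathbf{Y}\operatorname{diag}(\sqrt{\mathbf{p}})$ having entries $C_{k,j}$, $$R(\mathbf{Y},\mathbf{p})=\sum_{k=1}^K\log_2\Bigl(1+\frac{\alpha_q^2|C_{k,k}|^2}{\alpha_q^2\sum_{j\neq k}|C_{k,j}|^2+\alpha_q\beta_q\sum_{j=1}^K|C_{k,j}|^2+\sigma^2}\Bigr).$$ Transmit power: $P_{\mathrm{tx}}(\mathbf{p})=\alpha_q\mathbf{1}^{\mathsf T}\mathbf{p}$. Total power: $P_{\mathrm{tot}}(\mathbf{p})=P_{\mathrm{tx}}(\mathbf{p})/\eta_{\mathrm{PA}}+P_{\mathrm{st}}$. *)

theory Defs
  imports "HOL-Analysis.Analysis"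
begin

text \<open>A matrix with m rows and n columns has type \<open>complex ^ 'n ^ 'm\<close>.\<close>

definition adj :: "complex ^ 'n ^ 'm \<Rightarrow> complex ^ 'm ^ 'n" where
  "adj A = (\<chi> i j. cnj (A $ j $ i))"

text \<open>The product \<open>x\<^sup>H y\<close>, conjugate-linear in its first argument.\<close>

definition hdot :: "complex ^ 'n \<Rightarrow> complex ^ 'n \<Rightarrow> complex" where
  "hdot x y = (\<Sum>i\<in>UNIV. cnj (x $ i) * y $ i)"

definition hermitian :: "complex ^ 'n ^ 'n \<Rightarrow> bool" where
  "hermitian A \<longleftrightarrow> adj A = A"

text \<open>For Hermitian \<open>A\<close> the number \<open>x\<^sup>H A x\<close> is real, so taking \<open>Re\<close> below is only a change of type.\<close>

definition pos_semidef :: "complex ^ 'n ^ 'n \<Rightarrow> bool" where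
  "pos_semidef A \<longleftrightarrow> hermitian A \<and> (\<forall>x. 0 \<le> Re (hdot x (A *v x)))"

definition pos_def :: "complex ^ 'n ^ 'n \<Rightarrow> bool" where
  "pos_def A \<longleftrightarrow> hermitian A \<and> (\<forall>x. x \<noteq> 0 \<longrightarrow> 0 < Re (hdot x (A *v x)))"

definition loewner_le :: "complex ^ 'n ^ 'n \<Rightarrow> complex ^ 'n ^ 'n \<Rightarrow> bool"
    (infix "\<preceq>" 50) where
  "A \<preceq> B \<longleftrightarrow> pos_semidef (B - A)"

text \<open>Meaningful for positive definite \<open>A\<close>, where the root exists and is unique.\<close>

definition pd_sqrt :: "complex ^ 'n ^ 'n \<Rightarrow> complex ^ 'n ^ 'n" where
  "pd_sqrt A = (THE S. pos_def S \<and> S ** S = A)"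

definition diag :: "real ^ 'n \<Rightarrow> complex ^ 'n ^ 'n" where
  "diag p = (\<chi> i j. if i = j then complex_of_real (p $ i) else 0)"

definition vec_sqrt :: "real ^ 'n \<Rightarrow> real ^ 'n" where
  "vec_sqrt p = (\<chi> i. sqrt (p $ i))"

text \<open>The norm of \<open>complex ^ 'n\<close> is the Euclidean one, so its operator norm is the spectral norm.\<close>

definition spectral_norm :: "complex ^ 'n ^ 'm \<Rightarrow> real" where
  "spectral_norm A = onorm (\<lambda>x. A *v x)"

definition gram :: "complex ^ 'n ^ 'k \<Rightarrow> complex ^ 'k ^ 'k" where
  "gram H = H ** adj H"

text \<open>The channel vector \<open>h\<^sub>k\<close>: row \<open>k\<close> of \<open>H\<close> is \<open>h\<^sub>k\<^sup>H\<close>, whence the conjugate.\<close>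

definition channel :: "complex ^ 'n ^ 'k \<Rightarrow> 'k \<Rightarrow> complex ^ 'n" where
  "channel H k = (\<chi> i. cnj (H $ k $ i))"

definition quant_cov :: "real \<Rightarrow> real \<Rightarrow> complex ^ 'k ^ 'n \<Rightarrow> complex ^ 'n ^ 'n" where
  "quant_cov \<alpha> \<beta> W = (\<alpha> * \<beta>) *\<^sub>R (W ** adj W)"

text \<open>The quantization term \<open>h\<^sub>k\<^sup>H R\<^sub>q h\<^sub>k\<close> is real because \<open>R\<^sub>q\<close> is Hermitian.\<close>

definition sinr :: "real \<Rightarrow> real \<Rightarrow> real \<Rightarrow> complex ^ 'n ^ 'k \<Rightarrow> complex ^ 'k ^ 'n \<Rightarrow> 'k \<Rightarrow> real" where
  "sinr \<alpha> \<beta> \<sigma> H W k =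
     \<alpha>\<^sup>2 * (cmod (hdot (channel H k) (column k W)))\<^sup>2 /
     (\<alpha>\<^sup>2 * (\<Sum>j\<in>UNIV - {k}. (cmod (hdot (channel H k) (column j W)))\<^sup>2)
       + Re (hdot (channel H k) (quant_cov \<alpha> \<beta> W *v channel H k)) + \<sigma>\<^sup>2)"

definition full_rate :: "real \<Rightarrow> real \<Rightarrow> real \<Rightarrow> complex ^ 'n ^ 'k \<Rightarrow> complex ^ 'k ^ 'n \<Rightarrow> real" where
  "full_rate \<alpha> \<beta> \<sigma> H W = (\<Sum>k\<in>UNIV. log 2 (1 + sinr \<alpha> \<beta> \<sigma> H W k))"

definition reduced_rate ::
    "real \<Rightarrow> real \<Rightarrow> real \<Rightarrow> complex ^ 'n ^ 'k \<Rightarrow> complex ^ 'k ^ 'k \<Rightarrow> real ^ 'k \<Rightarrow> real" where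
  "reduced_rate \<alpha> \<beta> \<sigma> H Y p =
     (let C = pd_sqrt (gram H) ** Y ** diag (vec_sqrt p) in
      \<Sum>k\<in>UNIV. log 2 (1 +
        \<alpha>\<^sup>2 * (cmod (C $ k $ k))\<^sup>2 /
        (\<alpha>\<^sup>2 * (\<Sum>j\<in>UNIV - {k}. (cmod (C $ k $ j))\<^sup>2)
          + \<alpha> * \<beta> * (\<Sum>j\<in>UNIV. (cmod (C $ k $ j))\<^sup>2) + \<sigma>\<^sup>2)))"

definition tx_power :: "real \<Rightarrow> real ^ 'k \<Rightarrow> real" where
  "tx_power \<alpha> p = \<alpha> * (\<Sum>k\<in>UNIV. p $ k)"

definition tot_power :: "real \<Rightarrow> real \<Rightarrow> real \<Rightarrow> real ^ 'k \<Rightarrow> real" where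
  "tot_power \<eta> P\<^sub>s\<^sub>t \<alpha> p = tx_power \<alpha> p / \<eta> + P\<^sub>s\<^sub>t"

definition full_feasible :: "real \<Rightarrow> real \<Rightarrow> ((complex ^ 'k ^ 'n) \<times> (real ^ 'k)) set" where
  "full_feasible \<alpha> P\<^sub>m\<^sub>a\<^sub>x = {(W, p). adj W ** W \<preceq> diag p \<and> tx_power \<alpha> p \<le> P\<^sub>m\<^sub>a\<^sub>x}"

definition reduced_feasible :: "real \<Rightarrow> real \<Rightarrow> ((complex ^ 'k ^ 'k) \<times> (real ^ 'k)) set" where
  "reduced_feasible \<alpha> P\<^sub>m\<^sub>a\<^sub>x =
     {(Y, p). (\<forall>k. 0 \<le> p $ k) \<and> spectral_norm Y \<le> 1 \<and> tx_power \<alpha> p \<le> P\<^sub>m\<^sub>a\<^sub>x}"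

definition full_objective ::
    "real \<Rightarrow> real \<Rightarrow> real \<Rightarrow> real \<Rightarrow> real \<Rightarrow> real \<Rightarrow> complex ^ 'n ^ 'k \<Rightarrow>
     (complex ^ 'k ^ 'n) \<times> (real ^ 'k) \<Rightarrow> real" where
  "full_objective B \<eta> P\<^sub>s\<^sub>t \<alpha> \<beta> \<sigma> H =
     (\<lambda>(W, p). B * full_rate \<alpha> \<beta> \<sigma> H W / tot_power \<eta> P\<^sub>s\<^sub>t \<alpha> p)"

definition reduced_objective ::
    "real \<Rightarrow> real \<Rightarrow> real \<Rightarrow> real \<Rightarrow> real \<Rightarrow> real \<Rightarrow> complex ^ 'n ^ 'k \<Rightarrow>
     (complex ^ 'k ^ 'k) \<times> (real ^ 'k) \<Rightarrow> real" where
  "reduced_objective B \<eta> P\<^sub>s\<^sub>t \<alpha> \<beta> \<sigma> H =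
     (\<lambda>(Y, p). B * reduced_rate \<alpha> \<beta> \<sigma> H Y p / tot_power \<eta> P\<^sub>s\<^sub>t \<alpha> p)"

definition lift_precoder ::
    "complex ^ 'n ^ 'k \<Rightarrow> complex ^ 'k ^ 'k \<Rightarrow> real ^ 'k \<Rightarrow> complex ^ 'k ^ 'n" where
  "lift_precoder H Y p = adj H ** matrix_inv (pd_sqrt (gram H)) ** Y ** diag (vec_sqrt p)"

end

theory Submission
  imports Defs
begin

text \<open>With \<open>S\<close> the square root of \<open>H H\<^sup>H\<close>, the matrix \<open>H\<^sup>H S\<^sup>-\<^sup>1\<close> has orthonormal columns. Hence
  \<open>W = H\<^sup>H S\<^sup>-\<^sup>1 Y D\<close> with \<open>D\<^sup>2 = diag p\<close> satisfies \<open>W\<^sup>H W = D Y\<^sup>H Y D\<close> and \<open>H W = S Y D\<close>, and the rates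
  depend on \<open>W\<close> only through \<open>H W\<close>. Conversely, \<open>Y = S\<^sup>-\<^sup>1 H W D\<^sup>+\<close> is a contraction because
  \<open>S\<^sup>-\<^sup>1 H\<close> is one, and \<open>S Y D = H W\<close>. The existence of \<open>S\<close> is shown with Banach's fixed point
  theorem, its uniqueness with a trace argument.\<close>

section \<open>Fixed points of T = (B + T^2) / 2 for self-adjoint operators\<close>

text \<open>On \<open>complex ^ 'n\<close> the inner product is the real part of
  \<open>hdot\<close>, and bounded operators are only real-linear; complex linearity of the square
  root is recovered separately.\<close>

definition self_adjoint :: "'a::real_inner \<Rightarrow>\<^sub>L 'a \<Rightarrow> bool" where
  "self_adjoint T \<longleftrightarrow> (\<forall>x y. T x \<bullet> y = x \<bullet> T y)"

lemma closed_self_adjoint: "closed {T :: 'a::real_inner \<Rightarrow>\<^sub>L 'a. self_adjoint T}"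
  unfolding self_adjoint_def
  by (intro closed_Collect_all closed_Collect_eq continuous_intros)

text \<open>Supplies the Lipschitz constant of squaring on the ball of radius \<open>r\<close>; the
  factor 2 is cancelled by the 1/2 in the fixed point map.\<close>

lemma norm_square_diff_le:
  fixes S T :: "'a::real_normed_vector \<Rightarrow>\<^sub>L 'a"
  assumes "norm S \<le> r" "norm T \<le> r"
  shows "norm ((S o\<^sub>L S) - (T o\<^sub>L T)) \<le> 2 * r * norm (S - T)"
proof -
  have "(S o\<^sub>L S) - (T o\<^sub>L T) = (S o\<^sub>L (S - T)) + ((S - T) o\<^sub>L T)"
    by (rule blinfun_eqI) (simp add: blinfun.bilinear_simps)
  also have "norm \<dots> \<le> norm S * norm (S - T) + norm (S - T) * norm T"
    by (intro norm_triangle_le add_mono norm_blinfun_compose)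
  also have "\<dots> \<le> r * norm (S - T) + norm (S - T) * r"
    by (intro add_mono mult_right_mono mult_left_mono assms norm_ge_zero)
  finally show ?thesis by simp
qed

text \<open>The clause on \<open>J\<close> says that \<open>T\<close> commutes with everything that
  commutes with \<open>B\<close>; taking multiplication by \<i> for \<open>J\<close> later shows
  that \<open>T\<close> is complex-linear.\<close>

lemma square_root_fixed_point:
  fixes B :: "'a::{real_inner,banach} \<Rightarrow>\<^sub>L 'a"
  assumes "norm B < 1" "self_adjoint B"
  obtains T where "norm T < 1" "self_adjoint T" "T = (1/2) *\<^sub>R (B + (T o\<^sub>L T))"
    "\<And>J. J o\<^sub>L B = B o\<^sub>L J \<Longrightarrow> J o\<^sub>L T = T o\<^sub>L J"
proof -
  \<comment> \<open>\<open>r = 1 - s\<close> is the smaller root of r^2 - 2 r + norm B = 0: the map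
    sends the ball of radius \<open>r\<close> into itself, with contraction constant
    \<open>r < 1\<close>.\<close>
  obtain s where s: "0 < s" "s \<le> 1" "s * s = 1 - norm B"
    using that[of "sqrt (1 - norm B)"] assms(1) by simp
  define r where "r = 1 - s"
  have r: "0 \<le> r" "r < 1" using s by (auto simp: r_def)
  have r_eq: "(norm B + r * r) / 2 = r"
    using s(3) by (simp add: r_def field_simps)
  \<comment> \<open>Self-adjointness and the commutation rules are closed conditions preserved by
    \<open>f\<close>, so putting them into the domain makes the fixed point inherit them.\<close>
  define S where "S = cball 0 r \<inter> {T. self_adjoint T} \<inter> (\<Inter>J\<in>{J. J o\<^sub>L B = B o\<^sub>L J}. {T. J o\<^sub>L T = T o\<^sub>L J})"
  define f where "f T = (1/2) *\<^sub>R (B + (T o\<^sub>L T))" for T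
  have S_D: "norm T \<le> r" "self_adjoint T" "\<And>J. J o\<^sub>L B = B o\<^sub>L J \<Longrightarrow> J o\<^sub>L T = T o\<^sub>L J"
    if "T \<in> S" for T
    using that by (auto simp: S_def)
  have "closed S"
    unfolding S_def
    by (intro closed_Int closed_cball closed_self_adjoint closed_INT ballI closed_Collect_eq continuous_intros)
  then have "complete S" by (simp add: complete_eq_closed)
  moreover have "0 \<in> S"
    using r by (auto simp: S_def self_adjoint_def intro!: blinfun_eqI)
  moreover have "f ` S \<subseteq> S"
  proof (rule image_subsetI)
    fix T assume "T \<in> S"
    note T = S_D(1,2)[OF this] and comm = S_D(3)[OF this]
    have "norm (f T) \<le> (norm B + r * r) / 2"
    proof -
      have "norm (T o\<^sub>L T) \<le> r * r"
        using norm_blinfun_compose[of T T] mult_mono[OF T(1) T(1) r(1) norm_ge_zero] by linarith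
      then show ?thesis
        using norm_triangle_ineq[of B "T o\<^sub>L T"] by (simp add: f_def)
    qed
    moreover have "self_adjoint (f T)"
      using T(2) assms(2)
      by (simp add: self_adjoint_def f_def blinfun.bilinear_simps inner_add_left inner_add_right)
    moreover have "J o\<^sub>L f T = f T o\<^sub>L J" if J: "J o\<^sub>L B = B o\<^sub>L J" for J
    proof (rule blinfun_eqI)
      fix x
      have "J (B y) = B (J y)" "J (T y) = T (J y)" for y
        using J comm[OF J] by (metis blinfun_apply_blinfun_compose)+
      then show "(J o\<^sub>L f T) x = (f T o\<^sub>L J) x"
        by (simp add: f_def blinfun.bilinear_simps)
    qed
    ultimately show "f T \<in> S" using r_eq by (simp add: S_def)
  qed
  moreover have "dist (f T) (f U) \<le> r * dist T U" if "T \<in> S" "U \<in> S" for T U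
  proof -
    have "f T - f U = (1/2) *\<^sub>R ((T o\<^sub>L T) - (U o\<^sub>L U))"
      by (simp add: f_def algebra_simps)
    then have "norm (f T - f U) = norm ((T o\<^sub>L T) - (U o\<^sub>L U)) / 2"
      by simp
    then show ?thesis
      using norm_square_diff_le[of T r U] S_D(1)[OF that(1)] S_D(1)[OF that(2)] by (simp add: dist_norm)
  qed
  ultimately obtain T where "T \<in> S" "f T = T"
    using Banach_fix[of S r f] r by blast
  show ?thesis
  proof (rule that)
    show "norm T < 1" using S_D(1)[OF \<open>T \<in> S\<close>] r(2) by linarith
    show "self_adjoint T" by (rule S_D(2)[OF \<open>T \<in> S\<close>])
    show "T = (1/2) *\<^sub>R (B + (T o\<^sub>L T))"
      using \<open>f T = T\<close> unfolding f_def by (rule sym)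
  qed (rule S_D(3)[OF \<open>T \<in> S\<close>])
qed

section \<open>Adjoints, inner products and definiteness\<close>

lemma adj_adj [simp]: "adj (adj A) = A"
  by (simp add: adj_def vec_eq_iff)

lemma adj_mult: "adj (A ** B) = adj B ** adj A"
  by (simp add: adj_def matrix_matrix_mult_def vec_eq_iff mult.commute)

lemma adj_mat_1 [simp]: "adj (mat 1) = mat 1"
  by (auto simp: adj_def mat_def vec_eq_iff)

lemma adj_diff: "adj (A - B) = adj A - adj B"
  by (simp add: adj_def vec_eq_iff)

lemma adj_diag [simp]: "adj (diag p) = diag p"
  by (auto simp: adj_def diag_def vec_eq_iff)

lemma hdot_adj: "hdot x (A *v y) = hdot (adj A *v x) y"
  unfolding hdot_def matrix_vector_mult_def adj_def
  by (simp add: sum_distrib_left sum_distrib_right mult_ac) (subst sum.swap, rule refl)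

lemma Re_cnj_mult: "Re (cnj a * b) = a \<bullet> b"
  by (simp add: inner_complex_def)

lemma Re_hdot: "Re (hdot x y) = x \<bullet> y"
  by (simp only: hdot_def inner_vec_def Re_sum Re_cnj_mult)

lemma inner_adj:
  fixes A :: "complex ^ 'n ^ 'm"
  shows "x \<bullet> (A *v y) = (adj A *v x) \<bullet> y"
  by (metis Re_hdot hdot_adj)

text \<open>The real inner product suffices: symmetry makes \<open>A *v x - adj A *v x\<close>
  orthogonal to every vector, hence to itself.\<close>

lemma hermitian_iff_inner:
  "hermitian A \<longleftrightarrow> (\<forall>x y. (A *v x) \<bullet> y = x \<bullet> (A *v y))"
proof
  assume A: "\<forall>x y. (A *v x) \<bullet> y = x \<bullet> (A *v y)"
  have "A *v x = adj A *v x" for x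
  proof -
    have "(A *v x - adj A *v x) \<bullet> (A *v x - adj A *v x) = 0"
      using A by (simp add: inner_diff_left inner_adj)
    then show ?thesis by simp
  qed
  then show "hermitian A"
    by (simp add: hermitian_def matrix_eq)
qed (simp add: hermitian_def inner_adj)

lemma pos_def_iff: "pos_def A \<longleftrightarrow> hermitian A \<and> (\<forall>x. x \<noteq> 0 \<longrightarrow> 0 < x \<bullet> (A *v x))"
  by (simp add: pos_def_def Re_hdot)

lemma pos_semidef_iff: "pos_semidef A \<longleftrightarrow> hermitian A \<and> (\<forall>x. 0 \<le> x \<bullet> (A *v x))"
  by (simp add: pos_semidef_def Re_hdot)

lemma pos_def_invertible:
  assumes "pos_def A" shows "invertible A"
  using assms unfolding invertible_left_inverse matrix_left_invertible_ker pos_def_iff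
  by (metis inner_zero_right less_irrefl)

lemma bounded_linear_matrix_vector_mul:
  fixes A :: "complex ^ 'n ^ 'm"
  shows "bounded_linear ((*v) A)"
  by simp

section \<open>Existence of the positive definite square root\<close>

text \<open>\<open>m\<close> is the minimum of the quadratic form on the compact unit sphere;
  homogeneity of degree 2 extends the bound to all \<open>x\<close>.\<close>

lemma pos_def_coercive:
  fixes A :: "complex ^ 'n ^ 'n"
  assumes "pos_def A"
  obtains m where "0 < m" "\<And>x. m * (norm x)\<^sup>2 \<le> x \<bullet> (A *v x)"
proof -
  have "continuous_on (sphere 0 1) (\<lambda>x. x \<bullet> (A *v x))"
    by (intro continuous_intros linear_continuous_on bounded_linear_matrix_vector_mul)
  moreover have "axis undefined 1 \<in> sphere (0 :: complex ^ 'n) 1"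
    by (simp add: norm_eq_1 inner_axis_axis)
  ultimately obtain x0 where x0: "x0 \<in> sphere 0 1"
      "\<And>x. x \<in> sphere 0 1 \<Longrightarrow> x0 \<bullet> (A *v x0) \<le> x \<bullet> (A *v x)"
    using continuous_attains_inf[OF compact_sphere, of 0 1 "\<lambda>x. x \<bullet> (A *v x)"] by blast
  have lin: "linear ((*v) A)" by simp
  show ?thesis
  proof
    show "0 < x0 \<bullet> (A *v x0)"
    proof -
      have "x0 \<noteq> 0" using x0(1) by auto
      then show ?thesis using assms by (simp add: pos_def_iff)
    qed
    fix x :: "complex ^ 'n"
    show "(x0 \<bullet> (A *v x0)) * (norm x)\<^sup>2 \<le> x \<bullet> (A *v x)"
    proof (cases "x = 0")
      case False
      have "x0 \<bullet> (A *v x0) \<le> (x /\<^sub>R norm x) \<bullet> (A *v (x /\<^sub>R norm x))"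
        by (rule x0(2)) (use False in simp)
      also have "\<dots> = (x \<bullet> (A *v x)) / (norm x)\<^sup>2"
        by (simp add: linear_scale[OF lin] power2_eq_square divide_simps)
      finally show ?thesis
        using False by (simp add: field_simps)
    qed simp
  qed
qed

text \<open>Splitting a scalar into real and imaginary parts turns real linearity plus commutation
  with \<i> into complex linearity.\<close>

lemma blinfun_commutes_ii_imp_matrix:
  fixes T :: "(complex ^ 'n) \<Rightarrow>\<^sub>L (complex ^ 'm)"
  assumes "\<And>x. T (\<i> *s x) = \<i> *s T x"
  obtains M where "\<And>x. T x = M *v x"
proof -
  have "T (c *s x) = c *s T x" for c x
  proof -
    have eq: "c *s y = Re c *\<^sub>R y + Im c *\<^sub>R (\<i> *s y)" for y :: "complex ^ 'k"
      by (simp add: vec_eq_iff complex_eq_iff)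
    show ?thesis
      by (simp only: eq blinfun.bilinear_simps assms)
  qed
  then have "Vector_Spaces.linear (*s) (*s) T"
    by unfold_locales (simp_all add: blinfun.bilinear_simps)
  then show ?thesis
    using that matrix_works by metis
qed

lemma scaleR_matrix_vector_mul:
  fixes A :: "complex ^ 'n ^ 'm"
  shows "(r *\<^sub>R A) *v x = r *\<^sub>R (A *v x)"
  by (simp add: vec_eq_iff matrix_vector_mult_def scaleR_sum_right)

lemma pos_def_scaled_contraction:
  fixes A :: "complex ^ 'n ^ 'n"
  assumes "pos_def A"
  obtains c where "0 < c" "onorm (\<lambda>x. x - A *v x /\<^sub>R c) < 1"
proof -
  obtain m where m: "0 < m" "\<And>x. m * (norm x)\<^sup>2 \<le> x \<bullet> (A *v x)"
    using pos_def_coercive[OF assms] by blast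
  obtain M where M: "0 < M" "\<And>x. norm (A *v x) \<le> norm x * M"
    using bounded_linear.pos_bounded[OF bounded_linear_matrix_vector_mul[of A]] by blast
  \<comment> \<open>Expanding the square bounds the squared contraction factor by 1 - 2 m / c + M^2
    / c^2, which is least at this \<open>c\<close>, with value 1 - (m / M)^2.\<close>
  define c where "c = M\<^sup>2 / m"
  define b where "b = sqrt (1 - (m / M)\<^sup>2)"
  have c: "0 < c" using m M by (simp add: c_def)
  have sq: "(norm (x - A *v x /\<^sub>R c))\<^sup>2 \<le> (1 - (m / M)\<^sup>2) * (norm x)\<^sup>2" for x
  proof -
    have "(norm (x - A *v x /\<^sub>R c))\<^sup>2 = (norm x)\<^sup>2 - 2 / c * (x \<bullet> (A *v x)) + (norm (A *v x))\<^sup>2 / c\<^sup>2"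
    proof -
      have "(norm (x - y))\<^sup>2 = (norm x)\<^sup>2 - 2 * (x \<bullet> y) + (norm y)\<^sup>2" for y
        by (simp add: power2_norm_eq_inner inner_diff_left inner_diff_right inner_commute)
      then show ?thesis
        by (simp add: power_mult_distrib power_inverse divide_inverse mult_ac)
    qed
    also have "\<dots> \<le> (norm x)\<^sup>2 - 2 / c * (m * (norm x)\<^sup>2) + (norm x * M)\<^sup>2 / c\<^sup>2"
      using c m(2)[of x] M(2)[of x]
      by (intro add_mono diff_mono order_refl mult_left_mono divide_right_mono power_mono) auto
    also have "\<dots> = (1 - (m / M)\<^sup>2) * (norm x)\<^sup>2"
      using m(1) M(1) by (simp add: c_def field_simps power2_eq_square)
    finally show ?thesis .
  qed
  \<comment> \<open>At a unit vector, \<open>sq\<close> bounds a square by this number, so the root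
    defining \<open>b\<close> is a genuine one.\<close>
  have nonneg: "0 \<le> 1 - (m / M)\<^sup>2"
  proof -
    have "norm (axis undefined 1 :: complex ^ 'n) = 1"
      by (simp add: norm_eq_1 inner_axis_axis)
    then show ?thesis
      using order_trans[OF zero_le_power2 sq[of "axis undefined 1"]] by simp
  qed
  have "norm (x - A *v x /\<^sub>R c) \<le> b * norm x" for x
  proof (rule power2_le_imp_le)
    show "(norm (x - A *v x /\<^sub>R c))\<^sup>2 \<le> (b * norm x)\<^sup>2"
      using sq[of x] nonneg by (simp add: b_def power_mult_distrib)
  qed (use nonneg in \<open>simp add: b_def\<close>)
  then have "onorm (\<lambda>x. x - A *v x /\<^sub>R c) \<le> b"
    by (rule onorm_le)
  also have "b < 1" using m M by (simp add: b_def)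
  finally show ?thesis using that c by blast
qed

text \<open>With \<open>A / c = I - B\<close> and \<open>B\<close> a contraction, \<open>I - T\<close> is a square root of \<open>A / c\<close>
  exactly when \<open>T = (B + T\<^sup>2) / 2\<close>.\<close>

lemma pos_def_sqrt_exists:
  fixes A :: "complex ^ 'n ^ 'n"
  assumes "pos_def A"
  obtains S where "pos_def S" "S ** S = A"
proof -
  obtain c where c: "0 < c" "onorm (\<lambda>x. x - A *v x /\<^sub>R c) < 1"
    using pos_def_scaled_contraction[OF assms] .
  define B where "B = Blinfun (\<lambda>x. x - A *v x /\<^sub>R c)"
  have bl: "bounded_linear (\<lambda>x. x - A *v x /\<^sub>R c)"
    by (intro bounded_linear_sub bounded_linear_ident
        bounded_linear_compose[OF bounded_linear_scaleR_right] bounded_linear_matrix_vector_mul)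
  have B: "B x = x - A *v x /\<^sub>R c" for x
    using bounded_linear_Blinfun_apply[OF bl] by (simp add: B_def)
  have "norm B < 1"
    using c(2) by (simp add: norm_blinfun.rep_eq B[abs_def])
  moreover have "self_adjoint B"
    using assms by (simp add: self_adjoint_def B pos_def_iff hermitian_iff_inner inner_diff_left inner_diff_right)
  ultimately obtain T where T: "norm T < 1" "self_adjoint T" "T = (1/2) *\<^sub>R (B + (T o\<^sub>L T))"
    and comm: "\<And>J. J o\<^sub>L B = B o\<^sub>L J \<Longrightarrow> J o\<^sub>L T = T o\<^sub>L J"
    using square_root_fixed_point by blast
  have TT: "2 *\<^sub>R T x = B x + T (T x)" for x
    by (subst T(3)) (simp add: blinfun.bilinear_simps)
  \<comment> \<open>\<open>J\<close> is multiplication by \<i>. It commutes with \<open>B\<close>,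
    which comes from a complex matrix, hence with \<open>T\<close>; so \<open>T\<close> is a matrix
    too.\<close>
  define J :: "(complex ^ 'n) \<Rightarrow>\<^sub>L (complex ^ 'n)" where "J = Blinfun ((*v) (mat \<i>))"
  have matJ: "mat \<i> *v x = \<i> *s x" for x :: "complex ^ 'n"
    by (simp add: vec_eq_iff matrix_vector_mult_def mat_def if_distrib[of "\<lambda>t. t * _"] cong: if_cong)
  have J: "J x = \<i> *s x" for x
    unfolding J_def by (simp add: bounded_linear_Blinfun_apply matJ)
  have "J o\<^sub>L B = B o\<^sub>L J"
    by (rule blinfun_eqI)
      (simp add: J B vector_scalar_commute vec_eq_iff algebra_simps)
  then have "(J o\<^sub>L T) x = (T o\<^sub>L J) x" for x
    by (simp only: comm)
  then have "T (\<i> *s x) = \<i> *s T x" for x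
    by (simp add: J)
  then obtain N where N: "\<And>x. T x = N *v x"
    using blinfun_commutes_ii_imp_matrix by blast
  define S where "S = sqrt c *\<^sub>R (mat 1 - N)"
  have S: "S *v x = sqrt c *\<^sub>R (x - T x)" for x
    by (simp add: S_def scaleR_matrix_vector_mul matrix_vector_mult_diff_rdistrib N)
  show ?thesis
  proof
    have "S *v (S *v x) = A *v x" for x
    proof -
      have "S *v (S *v x) = c *\<^sub>R (x - 2 *\<^sub>R T x + T (T x))"
        using c(1) by (simp add: S blinfun.bilinear_simps algebra_simps scaleR_2)
      also have "\<dots> = A *v x"
        using c(1) by (simp add: TT B)
      finally show ?thesis .
    qed
    then show "S ** S = A"
      by (simp add: matrix_eq matrix_vector_mul_assoc)
    have "0 < x \<bullet> (S *v x)" if "x \<noteq> 0" for x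
    proof -
      \<comment> \<open>Cauchy-Schwarz and \<open>norm T < 1\<close> keep the form of
        \<open>T\<close> strictly below that of the identity, so I - T is positive definite.\<close>
      have "x \<bullet> T x \<le> norm x * (norm T * norm x)"
        using norm_cauchy_schwarz norm_blinfun[of T x]
        by (meson mult_left_mono norm_ge_zero order_trans)
      also have "\<dots> < norm x * (1 * norm x)"
        using T(1) that by simp
      finally show ?thesis
        using c(1) by (simp add: S inner_diff_right power2_norm_eq_inner[symmetric] power2_eq_square)
    qed
    moreover have "hermitian S"
      using T(2) by (simp add: hermitian_iff_inner S self_adjoint_def inner_diff_left inner_diff_right)
    ultimately show "pos_def S" by (simp add: pos_def_iff)
  qed
qed

section \<open>Uniqueness of the positive definite square root\<close>

text \<open>Row \<open>i\<close> of a Hermitian \<open>D\<close> is the conjugate of its column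
  \<open>i\<close>, so each diagonal entry of the product is the quadratic form of \<open>S\<close>
  at a column of \<open>D\<close>.\<close>

lemma trace_hermitian_conj:
  fixes D S :: "complex ^ 'n ^ 'n"
  assumes "hermitian D"
  shows "Re (trace (D ** S ** D)) = (\<Sum>i\<in>UNIV. column i D \<bullet> (S *v column i D))"
proof -
  have "cnj (D $ j $ i) = D $ i $ j" for i j
  proof -
    have "adj D $ i $ j = D $ i $ j" using assms by (simp add: hermitian_def)
    then show ?thesis by (simp add: adj_def)
  qed
  then have "(D ** S ** D) $ i $ i = hdot (column i D) (S *v column i D)" for i
    unfolding matrix_mul_assoc[symmetric]
    by (simp add: hdot_def column_def matrix_vector_mult_def matrix_matrix_mult_def)
  then show ?thesis
    by (simp add: trace_def Re_hdot[symmetric])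
qed

text \<open>For \<open>D = S - T\<close> one has \<open>S\<^sup>2 - T\<^sup>2 = S D + D T\<close>; multiplying by \<open>D\<close> and taking traces gives
  \<open>tr (D S D) + tr (D T D) = 0\<close> with both terms nonnegative.\<close>

lemma pos_def_sqrt_unique:
  fixes S T :: "complex ^ 'n ^ 'n"
  assumes "pos_def S" "pos_def T" "S ** S = T ** T"
  shows "S = T"
proof (rule ccontr)
  define D where "D = S - T"
  assume "S \<noteq> T"
  then have "D \<noteq> 0" by (simp add: D_def)
  have herm: "hermitian D"
    using assms by (simp add: D_def pos_def_iff hermitian_def adj_diff)
  have "S ** D + D ** T = 0"
    using assms(3) by (simp add: matrix_eq D_def matrix_vector_mult_add_rdistrib
        matrix_vector_mul_assoc[symmetric] matrix_vector_mult_diff_rdistrib matrix_vector_mult_diff_distrib)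
  then have "0 = trace (D ** (S ** D + D ** T))"
    by (simp add: trace_0 matrix_matrix_mult_def trace_def)
  also have "\<dots> = trace (D ** S ** D) + trace (D ** (D ** T))"
    by (simp add: matrix_add_ldistrib trace_add matrix_mul_assoc)
  \<comment> \<open>Cyclicity moves one factor \<open>D\<close> to the right of \<open>T\<close>, so
    that \<open>trace_hermitian_conj\<close> applies to this term as well.\<close>
  also have "trace (D ** (D ** T)) = trace (D ** T ** D)"
    by (metis trace_mul_sym)
  finally have "0 = Re (trace (D ** S ** D)) + Re (trace (D ** T ** D))"
    by (metis plus_complex.sel(1) zero_complex.sel(1))
  also have "\<dots> = (\<Sum>i\<in>UNIV. column i D \<bullet> (S *v column i D) + column i D \<bullet> (T *v column i D))"
    by (simp add: trace_hermitian_conj[OF herm] sum.distrib)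
  also have "\<dots> > 0"
  proof -
    obtain i where i: "column i D \<noteq> 0"
      using \<open>D \<noteq> 0\<close> by (auto simp: vec_eq_iff column_def)
    have nonneg: "0 \<le> x \<bullet> (S *v x)" "0 \<le> x \<bullet> (T *v x)" for x
      using assms(1,2) by (metis inner_zero_left less_imp_le order_refl pos_def_iff)+
    have "0 < column i D \<bullet> (S *v column i D)"
      using assms(1) i by (simp add: pos_def_iff)
    then show ?thesis
      using nonneg by (intro sum_pos2[of _ i]) (auto intro: add_pos_nonneg add_nonneg_nonneg)
  qed
  finally show False by simp
qed

lemma pd_sqrt:
  assumes "pos_def A"
  shows "pos_def (pd_sqrt A)" "pd_sqrt A ** pd_sqrt A = A"
proof -
  have "\<exists>!S. pos_def S \<and> S ** S = A"
    using pos_def_sqrt_exists[OF assms] pos_def_sqrt_unique by metis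
  from theI'[OF this] show "pos_def (pd_sqrt A)" "pd_sqrt A ** pd_sqrt A = A"
    by (simp_all add: pd_sqrt_def)
qed

section \<open>Full row rank and the Gram matrix\<close>

text \<open>A nontrivial relation would put one row into the span of the others, forcing the rank
  below the number of rows; independent rows give a right inverse.\<close>

lemma rank_eq_rows_right_inverse:
  fixes H :: "'a::field ^ 'n ^ 'k"
  assumes "rank H = CARD('k)"
  obtains G where "H ** G = mat 1"
proof -
  have "c i = 0" if c: "(\<Sum>i\<in>UNIV. c i *s row i H) = 0" for c i
  proof (rule ccontr)
    assume ci: "c i \<noteq> 0"
    let ?R = "(\<lambda>j. row j H) ` (UNIV - {i})"
    have "c i *s row i H = - (\<Sum>j\<in>UNIV - {i}. c j *s row j H)"
      using c by (simp add: sum.remove[of UNIV i] eq_neg_iff_add_eq_0)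
    also have "\<dots> \<in> vec.span ?R"
      by (intro vec.span_neg vec.span_sum vec.span_scale vec.span_base) auto
    finally have "inverse (c i) *s (c i *s row i H) \<in> vec.span ?R"
      by (rule vec.span_scale)
    then have "row i H \<in> vec.span ?R"
      using ci by simp
    then have "rows H \<subseteq> vec.span ?R"
      by (auto simp: rows_def intro: vec.span_base)
    then have "vec.dim (rows H) \<le> card ?R"
      by (intro vec.dim_le_card) auto
    also have "\<dots> \<le> card (UNIV - {i})" by (rule card_image_le) simp
    also have "\<dots> < CARD('k)" by (intro psubset_card_mono) auto
    finally show False using assms by (simp add: row_rank_def_gen)
  qed
  then have "\<exists>G. H ** G = mat 1"
    unfolding matrix_right_invertible_independent_rows by blast
  then show ?thesis using that by blast
qed

lemma inner_gram: "x \<bullet> (gram H *v x) = (norm (adj H *v x))\<^sup>2"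
  by (simp add: gram_def matrix_vector_mul_assoc[symmetric] inner_adj power2_norm_eq_inner)

lemma inner_adj_mult_self: "x \<bullet> ((adj W ** W) *v x) = (norm (W *v x))\<^sup>2"
  by (simp add: matrix_vector_mul_assoc[symmetric] inner_adj power2_norm_eq_inner)

lemma hermitian_gram: "hermitian (gram H)"
  by (simp add: hermitian_def gram_def adj_mult)

text \<open>The quadratic form at \<open>x\<close> is the squared norm of \<open>adj H *v x\<close>,
  and \<open>adj H\<close> is injective because a right inverse of \<open>H\<close> yields a left
  inverse of it.\<close>

lemma pos_def_gram:
  fixes H :: "complex ^ 'n ^ 'k"
  assumes "rank H = CARD('k)"
  shows "pos_def (gram H)"
proof -
  obtain G where "H ** G = mat 1"
    using rank_eq_rows_right_inverse[OF assms] .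
  then have "adj G ** adj H = mat 1"
    by (metis adj_mult adj_mat_1)
  then have "adj H *v x \<noteq> 0" if "x \<noteq> 0" for x
    using that by (metis matrix_left_invertible_ker)
  then show ?thesis
    by (simp add: pos_def_iff hermitian_gram inner_gram)
qed

section \<open>Inverses, diagonal matrices and the constraints as norm inequalities\<close>

lemma matrix_inv_mult:
  assumes "invertible A"
  shows "A ** matrix_inv A = mat 1" "matrix_inv A ** A = mat 1"
  using someI_ex[OF assms[unfolded invertible_def]] by (simp_all add: matrix_inv_def)

lemma adj_matrix_inv_hermitian:
  fixes S :: "complex ^ 'n ^ 'n"
  assumes "hermitian S" "invertible S"
  shows "adj (matrix_inv S) = matrix_inv S"
proof -
  have "adj (matrix_inv S) ** S = mat 1"
    using adj_mult[of S "matrix_inv S"] assms by (simp add: matrix_inv_mult hermitian_def)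
  then show ?thesis
    by (metis assms(2) matrix_inv_mult(1) matrix_mul_assoc matrix_mul_lid matrix_mul_rid)
qed

lemma diag_mult: "diag p ** diag q = diag (\<chi> i. p $ i * q $ i)"
  by (simp add: diag_def matrix_matrix_mult_def vec_eq_iff if_distrib[of "\<lambda>t. t * _"] cong: if_cong)

lemma diag_vec_sqrt_square:
  assumes "\<forall>i. 0 \<le> p $ i"
  shows "diag (vec_sqrt p) ** diag (vec_sqrt p) = diag p"
  using assms by (simp add: diag_mult vec_sqrt_def)

lemma mult_diag_nth: "(A ** diag p) $ i $ j = A $ i $ j * complex_of_real (p $ j)"
  by (simp add: diag_def matrix_matrix_mult_def if_distrib[of "\<lambda>t. _ * t"] cong: if_cong)

text \<open>Both quadratic forms are squared norms, and the difference is automatically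
  Hermitian.\<close>

lemma gram_le_diag_iff:
  assumes "\<forall>i. 0 \<le> p $ i"
  shows "adj W ** W \<preceq> diag p \<longleftrightarrow> (\<forall>x. norm (W *v x) \<le> norm (diag (vec_sqrt p) *v x))"
proof -
  have "x \<bullet> (diag p *v x) = (norm (diag (vec_sqrt p) *v x))\<^sup>2" for x
    using inner_adj_mult_self[of x "diag (vec_sqrt p)"] by (simp add: diag_vec_sqrt_square[OF assms])
  moreover have "hermitian (diag p - adj W ** W)"
    by (simp add: hermitian_def adj_diff adj_mult)
  ultimately show ?thesis
    by (simp add: loewner_le_def pos_semidef_iff matrix_vector_mult_diff_rdistrib inner_diff_right
        inner_adj_mult_self power_mono_iff)
qed

text \<open>Testing the order at a unit coordinate vector. This yields \<open>p \<ge> 0\<close>,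
  which the full problem does not list as a constraint, and makes column \<open>k\<close> vanish
  where \<open>p $ k = 0\<close>.\<close>

lemma gram_le_diag_norm_column:
  assumes "adj W ** W \<preceq> diag p"
  shows "(norm (column k W))\<^sup>2 \<le> p $ k"
proof -
  have "W *v axis k 1 = column k W"
    by (simp add: vec_eq_iff matrix_vector_mult_def column_def axis_def if_distrib[of "\<lambda>t. _ * t"] cong: if_cong)
  moreover have "axis k 1 \<bullet> (diag p *v axis k 1) = p $ k"
    unfolding inner_axis'
    by (simp add: matrix_vector_mult_def diag_def axis_def inner_complex_def
        if_distrib[of "\<lambda>t. _ * t"] cong: if_cong)
  moreover have "0 \<le> axis k 1 \<bullet> ((diag p - adj W ** W) *v axis k 1)"
    using assms by (simp add: loewner_le_def pos_semidef_iff)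
  ultimately show ?thesis
    by (simp add: matrix_vector_mult_diff_rdistrib inner_diff_right inner_adj_mult_self)
qed

lemma spectral_norm_le_1_iff:
  "spectral_norm A \<le> 1 \<longleftrightarrow> (\<forall>x. norm (A *v x) \<le> norm x)"
proof
  assume le: "spectral_norm A \<le> 1"
  show "\<forall>x. norm (A *v x) \<le> norm x"
  proof
    fix x
    have "norm (A *v x) \<le> spectral_norm A * norm x"
      unfolding spectral_norm_def by (rule onorm[OF bounded_linear_matrix_vector_mul])
    also have "\<dots> \<le> 1 * norm x" using le by (intro mult_right_mono) auto
    finally show "norm (A *v x) \<le> norm x" by simp
  qed
qed (simp add: spectral_norm_def onorm_le)

section \<open>Rates and feasible points of the two problems\<close>

text \<open>Shows that \<open>W\<close> enters the rate only through \<open>H ** W\<close>: the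
  signal products are its entries, and the quantization term is a multiple of the squared norm of
  its row \<open>k\<close>.\<close>

lemma full_rate_eq:
  fixes H :: "complex ^ 'n ^ 'k" and W :: "complex ^ 'k ^ 'n"
  shows "full_rate \<alpha> \<beta> \<sigma> H W =
    (let C = H ** W in \<Sum>k\<in>UNIV. log 2 (1 +
        \<alpha>\<^sup>2 * (cmod (C $ k $ k))\<^sup>2 /
        (\<alpha>\<^sup>2 * (\<Sum>j\<in>UNIV - {k}. (cmod (C $ k $ j))\<^sup>2)
          + \<alpha> * \<beta> * (\<Sum>j\<in>UNIV. (cmod (C $ k $ j))\<^sup>2) + \<sigma>\<^sup>2)))"
proof -
  have entry: "hdot (channel H k) (column j W) = (H ** W) $ k $ j" for k j
    by (simp add: hdot_def channel_def column_def matrix_matrix_mult_def)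
  have noise: "Re (hdot (channel H k) (quant_cov \<alpha> \<beta> W *v channel H k)) =
      \<alpha> * \<beta> * (\<Sum>j\<in>UNIV. (cmod ((H ** W) $ k $ j))\<^sup>2)" for k
  proof -
    have "(adj W *v channel H k) $ j = cnj ((H ** W) $ k $ j)" for j
      by (simp add: adj_def channel_def matrix_vector_mult_def matrix_matrix_mult_def mult.commute)
    then have "(norm (adj W *v channel H k))\<^sup>2 = (\<Sum>j\<in>UNIV. (cmod ((H ** W) $ k $ j))\<^sup>2)"
      by (simp add: norm_vec_def L2_set_def sum_nonneg)
    then show ?thesis
      using inner_gram[of "channel H k" W]
      by (simp add: Re_hdot quant_cov_def scaleR_matrix_vector_mul gram_def)
  qed
  show ?thesis
    by (simp add: full_rate_def sinr_def entry noise Let_def)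
qed

lemma reduced_rate_eq_full_rate:
  assumes "H ** W = pd_sqrt (gram H) ** Y ** diag (vec_sqrt p)"
  shows "reduced_rate \<alpha> \<beta> \<sigma> H Y p = full_rate \<alpha> \<beta> \<sigma> H W"
  by (simp add: full_rate_eq reduced_rate_def assms)

text \<open>Put Q = \<open>adj H ** matrix_inv S\<close>. Then Q^H Q = S^-1 S^2 S^-1 = I, so Q is an
  isometry; the second map is Q^H, a contraction.\<close>

lemma norm_whitened:
  fixes H :: "complex ^ 'n ^ 'k"
  assumes "hermitian S" "invertible S" "S ** S = gram H"
  shows "norm (adj H *v (matrix_inv S *v y)) = norm y"
    and "norm (matrix_inv S *v (H *v z)) \<le> norm z"
proof -
  let ?R = "matrix_inv S"
  have R: "adj ?R = ?R" "?R ** S = mat 1" "S ** ?R = mat 1"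
    using assms by (simp_all add: adj_matrix_inv_hermitian matrix_inv_mult)
  have iso: "norm (adj H *v (?R *v y)) = norm y" for y
  proof -
    have "(norm (adj H *v (?R *v y)))\<^sup>2 = (?R *v y) \<bullet> (gram H *v (?R *v y))"
      by (simp add: inner_gram)
    also have "\<dots> = (?R *v y) \<bullet> (S *v ((S ** ?R) *v y))"
      by (simp only: assms(3)[symmetric] matrix_vector_mul_assoc matrix_mul_assoc)
    also have "\<dots> = y \<bullet> ((?R ** S) *v y)"
      by (simp add: R inner_adj[of y ?R] matrix_vector_mul_assoc[symmetric] del: R(2))
    also have "\<dots> = (norm y)\<^sup>2" by (simp add: R power2_norm_eq_inner)
    finally show ?thesis by simp
  qed
  then show "norm (adj H *v (?R *v y)) = norm y" .
  let ?v = "?R *v (H *v z)"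
  \<comment> \<open>With v = Q^H z, the square of its norm is the inner product of Q v and z, at
    most norm v * norm z because Q is isometric.\<close>
  have "(norm ?v)\<^sup>2 = (adj H *v (?R *v ?v)) \<bullet> z"
    by (simp add: power2_norm_eq_inner inner_adj[of ?v ?R] inner_adj[of _ H] R(1))
  also have "\<dots> \<le> norm ?v * norm z"
    using norm_cauchy_schwarz[of "adj H *v (?R *v ?v)" z] by (simp only: iso)
  finally show "norm ?v \<le> norm z"
    by (cases "?v = 0") (auto simp: power2_eq_square)
qed



lemma lift_precoder_feasible:
  fixes H :: "complex ^ 'n ^ 'k"
  assumes "pos_def (gram H)" "(Y, p) \<in> reduced_feasible \<alpha> P"
  shows "(lift_precoder H Y p, p) \<in> full_feasible \<alpha> P"
    and "full_rate \<alpha> \<beta> \<sigma> H (lift_precoder H Y p) = reduced_rate \<alpha> \<beta> \<sigma> H Y p"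
proof -
  define S where "S = pd_sqrt (gram H)"
  have S: "hermitian S" "invertible S" "S ** S = gram H"
    using pd_sqrt[OF assms(1)] pos_def_invertible by (auto simp: S_def pos_def_iff)
  have p: "\<forall>k. 0 \<le> p $ k" and Y: "\<And>x. norm (Y *v x) \<le> norm x" and tx: "tx_power \<alpha> p \<le> P"
    using assms(2) by (auto simp: reduced_feasible_def spectral_norm_le_1_iff)
  let ?D = "diag (vec_sqrt p)"
  have W: "lift_precoder H Y p = adj H ** matrix_inv S ** Y ** ?D"
    by (simp add: lift_precoder_def S_def)
  \<comment> \<open>The isometry drops out of the norm, leaving \<open>Y\<close> applied to
    \<open>?D *v x\<close>, where \<open>Y\<close> is a contraction.\<close>
  have "norm (lift_precoder H Y p *v x) \<le> norm (?D *v x)" for x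
    using Y by (simp add: W matrix_vector_mul_assoc[symmetric] norm_whitened(1)[OF S])
  then show "(lift_precoder H Y p, p) \<in> full_feasible \<alpha> P"
    using tx by (simp add: full_feasible_def gram_le_diag_iff[OF p])
  have "H ** lift_precoder H Y p = (gram H ** matrix_inv S) ** Y ** ?D"
    by (simp add: W gram_def matrix_mul_assoc)
  also have "gram H ** matrix_inv S = S"
    using S by (metis matrix_inv_mult(1) matrix_mul_assoc matrix_mul_rid)
  finally show "full_rate \<alpha> \<beta> \<sigma> H (lift_precoder H Y p) = reduced_rate \<alpha> \<beta> \<sigma> H Y p"
    by (simp add: reduced_rate_eq_full_rate S_def)
qed

lemma full_feasible_reduces:
  fixes H :: "complex ^ 'n ^ 'k"
  assumes "pos_def (gram H)" "(W, p) \<in> full_feasible \<alpha> P"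
  obtains Y where "(Y, p) \<in> reduced_feasible \<alpha> P"
    "reduced_rate \<alpha> \<beta> \<sigma> H Y p = full_rate \<alpha> \<beta> \<sigma> H W"
proof -
  define S where "S = pd_sqrt (gram H)"
  have S: "hermitian S" "invertible S" "S ** S = gram H"
    using pd_sqrt[OF assms(1)] pos_def_invertible by (auto simp: S_def pos_def_iff)
  have le: "adj W ** W \<preceq> diag p" and tx: "tx_power \<alpha> p \<le> P"
    using assms(2) by (auto simp: full_feasible_def)
  \<comment> \<open>Needed twice: for the sign of \<open>p\<close>, and to control the coordinates
    where \<open>?D\<close> is singular.\<close>
  have col: "(norm (column k W))\<^sup>2 \<le> p $ k" for k
    by (rule gram_le_diag_norm_column[OF le])
  then have p: "\<forall>k. 0 \<le> p $ k"
    using zero_le_power2 order_trans by blast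
  let ?D = "diag (vec_sqrt p)"
  \<comment> \<open>Where \<open>p $ k = 0\<close> the division gives \<open>0\<close>, which suits, as column \<open>k\<close> of \<open>W\<close> vanishes there.\<close>
  define E where "E = diag (\<chi> k. 1 / sqrt (p $ k))"
  define Y where "Y = matrix_inv S ** H ** W ** E"
  \<comment> \<open>\<open>E ** ?D\<close> is only the projection onto the coordinates with
    \<open>p $ k > 0\<close>, but \<open>W\<close> has zero columns at the others.\<close>
  have WED: "W ** E ** ?D = W"
  proof -
    have "W $ i $ k = 0" if "p $ k = 0" for i k
      using col[of k] that by (auto simp: column_def vec_eq_iff)
    then have "(W ** E ** ?D) $ i $ k = W $ i $ k" for i k
      by (cases "p $ k = 0") (auto simp: E_def mult_diag_nth vec_sqrt_def of_real_divide)
    then show ?thesis by (simp add: vec_eq_iff)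
  qed
  have "norm (Y *v x) \<le> norm x" for x
  proof -
    have "norm (Y *v x) \<le> norm (W *v (E *v x))"
      using norm_whitened(2)[OF S, of "W *v (E *v x)"]
      by (simp add: Y_def matrix_vector_mul_assoc[symmetric])
    also have "\<dots> \<le> norm (?D *v (E *v x))"
      using le gram_le_diag_iff[OF p, of W] by blast
    \<comment> \<open>\<open>?D ** E\<close> is diagonal with entries 0 or 1, so no component
      grows.\<close>
    also have "\<dots> \<le> norm x"
    proof (rule norm_le_componentwise_cart)
      fix k
      have "?D *v (E *v x) = diag (\<chi> k. sqrt (p $ k) * (1 / sqrt (p $ k))) *v x"
        by (simp add: matrix_vector_mul_assoc E_def diag_mult vec_sqrt_def)
      moreover have "norm ((diag q *v x) $ k) = \<bar>q $ k\<bar> * norm (x $ k)" for q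
        by (simp add: diag_def matrix_vector_mult_def norm_mult if_distrib[of "\<lambda>t. t * _"] cong: if_cong)
      ultimately show "norm ((?D *v (E *v x)) $ k) \<le> norm (x $ k)"
        by simp
    qed
    finally show ?thesis .
  qed
  then have "(Y, p) \<in> reduced_feasible \<alpha> P"
    using p tx by (simp add: reduced_feasible_def spectral_norm_le_1_iff)
  moreover have "S ** Y ** ?D = (S ** matrix_inv S) ** H ** (W ** E ** ?D)"
    by (simp add: Y_def matrix_mul_assoc)
  then have "S ** Y ** ?D = H ** W"
    using S by (simp add: WED matrix_inv_mult)
  then have "reduced_rate \<alpha> \<beta> \<sigma> H Y p = full_rate \<alpha> \<beta> \<sigma> H W"
    by (intro reduced_rate_eq_full_rate) (simp add: S_def)
  ultimately show ?thesis using that by blast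
qed

section \<open>Equality of the optimal values and transfer of maximizers\<close>

theorem proposition3:
  fixes H :: "complex ^ 'n ^ 'k"
    and B \<sigma> P\<^sub>m\<^sub>a\<^sub>x \<eta> P\<^sub>s\<^sub>t \<alpha> \<beta> :: real
  assumes "B > 0" and "\<sigma>\<^sup>2 > 0" and "P\<^sub>m\<^sub>a\<^sub>x > 0" and "\<eta> > 0" and "P\<^sub>s\<^sub>t > 0"
    and "0 < \<beta>" and "\<beta> < 1" and "\<alpha> = 1 - \<beta>"
    and "CARD('k) \<le> CARD('n)"
    and "rank H = CARD('k)"
  shows
    "(\<forall>Y p. (Y, p) \<in> reduced_feasible \<alpha> P\<^sub>m\<^sub>a\<^sub>x \<longrightarrow>
        (let W = lift_precoder H Y p in
          (W, p) \<in> full_feasible \<alpha> P\<^sub>m\<^sub>a\<^sub>x \<and>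
          full_rate \<alpha> \<beta> \<sigma> H W = reduced_rate \<alpha> \<beta> \<sigma> H Y p \<and>
          tx_power \<alpha> p = tx_power \<alpha> p \<and>
          tot_power \<eta> P\<^sub>s\<^sub>t \<alpha> p = tot_power \<eta> P\<^sub>s\<^sub>t \<alpha> p)) \<and>
     (\<forall>(W :: complex ^ 'k ^ 'n) p. (W, p) \<in> full_feasible \<alpha> P\<^sub>m\<^sub>a\<^sub>x \<longrightarrow>
        (\<exists>Y. (Y, p) \<in> reduced_feasible \<alpha> P\<^sub>m\<^sub>a\<^sub>x \<and>
          reduced_rate \<alpha> \<beta> \<sigma> H Y p = full_rate \<alpha> \<beta> \<sigma> H W \<and>
          tx_power \<alpha> p = tx_power \<alpha> p \<and>
          tot_power \<eta> P\<^sub>s\<^sub>t \<alpha> p = tot_power \<eta> P\<^sub>s\<^sub>t \<alpha> p)) \<and>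
     (SUP z\<in>full_feasible \<alpha> P\<^sub>m\<^sub>a\<^sub>x. ereal (full_objective B \<eta> P\<^sub>s\<^sub>t \<alpha> \<beta> \<sigma> H z)) =
       (SUP x\<in>reduced_feasible \<alpha> P\<^sub>m\<^sub>a\<^sub>x. ereal (reduced_objective B \<eta> P\<^sub>s\<^sub>t \<alpha> \<beta> \<sigma> H x)) \<and>
     (\<forall>Y p. is_arg_max (reduced_objective B \<eta> P\<^sub>s\<^sub>t \<alpha> \<beta> \<sigma> H) (\<lambda>x. x \<in> reduced_feasible \<alpha> P\<^sub>m\<^sub>a\<^sub>x) (Y, p) \<longrightarrow>
        is_arg_max (full_objective B \<eta> P\<^sub>s\<^sub>t \<alpha> \<beta> \<sigma> H) (\<lambda>z. z \<in> full_feasible \<alpha> P\<^sub>m\<^sub>a\<^sub>x) (lift_precoder H Y p, p))"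
proof -
  have pd: "pos_def (gram H)" by (rule pos_def_gram) fact
  let ?F = "full_feasible \<alpha> P\<^sub>m\<^sub>a\<^sub>x :: ((complex ^ 'k ^ 'n) \<times> (real ^ 'k)) set"
  let ?R = "reduced_feasible \<alpha> P\<^sub>m\<^sub>a\<^sub>x :: ((complex ^ 'k ^ 'k) \<times> (real ^ 'k)) set"
  let ?f = "full_objective B \<eta> P\<^sub>s\<^sub>t \<alpha> \<beta> \<sigma> H"
  let ?r = "reduced_objective B \<eta> P\<^sub>s\<^sub>t \<alpha> \<beta> \<sigma> H"
  note lift = lift_precoder_feasible[OF pd]
  have lift_obj: "?f (lift_precoder H Y p, p) = ?r (Y, p)" if "(Y, p) \<in> ?R" for Y p
    using lift(2)[OF that] by (simp add: full_objective_def reduced_objective_def)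
  have reduce: "\<exists>Y. (Y, p) \<in> ?R \<and> reduced_rate \<alpha> \<beta> \<sigma> H Y p = full_rate \<alpha> \<beta> \<sigma> H W"
    if "(W, p) \<in> ?F" for W p
    using full_feasible_reduces[OF pd that] by metis
  have reduce_obj: "\<exists>x\<in>?R. ?r x = ?f z" if "z \<in> ?F" for z
  proof -
    obtain W p where z: "z = (W, p)" by (cases z)
    from reduce[OF that[unfolded z]] show ?thesis
      by (force simp: z full_objective_def reduced_objective_def)
  qed
  \<comment> \<open>The two objectives take the same values on their feasible sets, so the
    extended-real suprema agree whether or not they are attained.\<close>
  have "(SUP z\<in>?F. ereal (?f z)) = (SUP x\<in>?R. ereal (?r x))"
  proof (rule SUP_eq)
    show "\<exists>x\<in>?R. ereal (?f z) \<le> ereal (?r x)" if "z \<in> ?F" for z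
      using reduce_obj[OF that] by force
    show "\<exists>z\<in>?F. ereal (?r x) \<le> ereal (?f z)" if "x \<in> ?R" for x
    proof -
      obtain Y p where "x = (Y, p)" by (cases x)
      then show ?thesis
        using that lift(1) lift_obj by (intro bexI[of _ "(lift_precoder H Y p, p)"]) auto
    qed
  qed
  moreover have "is_arg_max ?f (\<lambda>z. z \<in> ?F) (lift_precoder H Y p, p)"
    if "is_arg_max ?r (\<lambda>x. x \<in> ?R) (Y, p)" for Y p
  proof -
    have R: "(Y, p) \<in> ?R" and max: "\<And>x. x \<in> ?R \<Longrightarrow> ?r x \<le> ?r (Y, p)"
      using that by (auto simp: is_arg_max_def not_less)
    \<comment> \<open>Pass from \<open>z\<close> to a reduced point of equal value, compare it with
      the maximizer \<open>(Y, p)\<close>, and lift back at equal value.\<close>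
    have "?f z \<le> ?f (lift_precoder H Y p, p)" if "z \<in> ?F" for z
      using reduce_obj[OF that] max lift_obj[OF R] by metis
    then show ?thesis
      using lift(1)[OF R] by (auto simp: is_arg_max_def not_less)
  qed
  ultimately show ?thesis
    using lift reduce by (simp add: Let_def)
qed

end
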